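(* Given the computation load $L$ and deadline $T$ at the user, with $\ell_{\min}^+\le U_K$, the energy-efficient data-partitioning policy, i.e. the solution of $$\min_{\ell}\ (L-\ell)\,C\,P_{\rm cyc}+E_{\rm off}(\ell)\quad\text{s.t. }\ \ell_{\min}^+\le\ell\le L$$ (where offloading $\ell$ bits is feasible only if $\ell\le U_K$), is $$\ell^*=\max\big\{\ell_{\min}^+,\ \min\{\ell_0,\ U_K,\ L\}\big\},$$ where $\ell_0$ is the solution of $E_{\rm off}'(\ell_0)=C\,P_{\rm cyc}$ and $E_{\rm off}'$ denotes the first derivative of $E_{\rm off}$.
   Context: A user has $L$ bits of data to process by deadline $T$; it offloads $\ell$ bits to a helper and computes $L-\ell$ bits locally. The user's CPU frequency is $f>0$, $C>0$ CPU cycles are required per bit, and each local CPU cycle costs energy $P_{\rm cyc}>0$. The local deadline constraint $C(L-\ell)/f\le T$ gives $\ell\ge\ell_{\min}^+$ with $\ell_{\min}=L-fT/C$ and $x^+=[x]^+=\max\{x,0\}$. The helper's CPU timeline is divided into epochs $k=1,\dots,K$ of lengths $\tau_k>0$, with $a_k\in\{0,1\}$ indicating whether the CPU is idle ($1$) or busy ($0$) in epoch $k$; consecutive epochs have different states, epoch $K$ is idle, and $\sum_{k=1}^K\tau_k\le T$. With helper CPU frequency $f_h>0$, the CPU-idling profile is $U_k=\sum_{j=1}^ka_j\tau_jf_h/C$. The helper's buffer is large (at least $L$ bits). For $0\le\ell\le U_K$ let $$\bar{\mathcal T}(\ell)=\Big\{\boldsymbol{\ell}=(\ell_1,\dots,\ell_K)\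 :\ [U_k-\Delta(\ell)]^+\le\sum_{j=1}^k\ell_j\le\ell,\ k=1,\dots,K-1,\ \sum_{k=1}^K\ell_k=\ell\Big\},\quad \Delta(\ell)=U_K-\ell.$$ The minimum transmission energy for offloading $\ell$ bits is $$E_{\rm off}(\ell)=\min_{\boldsymbol{\ell}\ge\boldsymbol 0,\ \boldsymbol{\ell}\in\bar{\mathcal T}(\ell)}\ \sum_{k=1}^K\frac{\tau_k}{h^2}\,g\!\left(\frac{\ell_k}{\tau_k}\right),\qquad g(x)=N_0(2^{x/W}-1),$$ with constants $h,N_0,W>0$. *)

theory Defs
  imports "HOL-Analysis.Analysis"
begin

text \<open>
  Epochs are numbered \<open>1, \<dots>, K\<close>; sequences indexed by epochs are functions on \<open>nat\<close> whose values
  outside \<open>{1..K}\<close> play no role.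
\<close>

definition cpu_idling_profile ::
    "(nat \<Rightarrow> real) \<Rightarrow> (nat \<Rightarrow> real) \<Rightarrow> real \<Rightarrow> real \<Rightarrow> nat \<Rightarrow> real" where
  "cpu_idling_profile a \<tau> f\<^sub>h C k = (\<Sum>j=1..k. a j * \<tau> j * f\<^sub>h / C)"

definition helper_timeline :: "nat \<Rightarrow> real \<Rightarrow> (nat \<Rightarrow> real) \<Rightarrow> (nat \<Rightarrow> real) \<Rightarrow> bool" where
  "helper_timeline K T a \<tau> \<longleftrightarrow>
     1 \<le> K \<and>
     (\<forall>k\<in>{1..K}. 0 < \<tau> k) \<and>
     (\<forall>k\<in>{1..K}. a k \<in> {0, 1}) \<and>
     (\<forall>k\<in>{1..<K}. a k \<noteq> a (Suc k)) \<and>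
     a K = 1 \<and>
     (\<Sum>k=1..K. \<tau> k) \<le> T"

definition offload_set :: "nat \<Rightarrow> (nat \<Rightarrow> real) \<Rightarrow> real \<Rightarrow> (nat \<Rightarrow> real) set" where
  "offload_set K U l =
     {x. (\<forall>k\<in>{1..<K}. max 0 (U k - (U K - l)) \<le> (\<Sum>j=1..k. x j) \<and> (\<Sum>j=1..k. x j) \<le> l) \<and>
         (\<Sum>k=1..K. x k) = l}"

definition rate_power :: "real \<Rightarrow> real \<Rightarrow> real \<Rightarrow> real" where
  "rate_power N\<^sub>0 W x = N\<^sub>0 * (2 powr (x / W) - 1)"

definition transmission_energy ::
    "nat \<Rightarrow> (nat \<Rightarrow> real) \<Rightarrow> real \<Rightarrow> real \<Rightarrow> real \<Rightarrow> (nat \<Rightarrow> real) \<Rightarrow> real" where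
  "transmission_energy K \<tau> h N\<^sub>0 W x = (\<Sum>k=1..K. \<tau> k / h\<^sup>2 * rate_power N\<^sub>0 W (x k / \<tau> k))"

text \<open>
  The infimum is a minimum for every \<open>l \<ge> 0\<close>: see \<open>E_off_attained\<close> below. The same formula is
  used beyond \<open>l = U K\<close>, where offloading is not feasible but the constraint set is still
  nonempty; values there matter only for locating a stationary point larger than \<open>U K\<close>.
\<close>

definition E_off ::
    "nat \<Rightarrow> (nat \<Rightarrow> real) \<Rightarrow> (nat \<Rightarrow> real) \<Rightarrow> real \<Rightarrow> real \<Rightarrow> real \<Rightarrow> real \<Rightarrow> real" where
  "E_off K \<tau> U h N\<^sub>0 W l =
     (INF x \<in> {x. (\<forall>k\<in>{1..K}. 0 \<le> x k) \<and> x \<in> offload_set K U l}.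
        transmission_energy K \<tau> h N\<^sub>0 W x)"

definition min_offload :: "real \<Rightarrow> real \<Rightarrow> real \<Rightarrow> real \<Rightarrow> real" where
  "min_offload L f T C = L - f * T / C"

lemma cpu_idling_profile_mono:
  assumes "helper_timeline K T a \<tau>" "0 < f\<^sub>h" "0 < C" "k \<le> K"
  shows "cpu_idling_profile a \<tau> f\<^sub>h C k \<le> cpu_idling_profile a \<tau> f\<^sub>h C K"
  unfolding cpu_idling_profile_def
proof (rule sum_mono2)
  fix b assume "b \<in> {1..K} - {1..k}"
  then have "0 < \<tau> b" "a b \<in> {0, 1}"
    using assms(1) by (auto simp: helper_timeline_def)
  then show "0 \<le> a b * \<tau> b * f\<^sub>h / C"
    using assms(2,3) by auto
qed (use assms(4) in auto)

lemma E_off_attained: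
  assumes \<tau>: "\<And>k. k \<in> {1..K} \<Longrightarrow> 0 < \<tau> k" and "1 \<le> K" and "0 \<le> l" and "W \<noteq> 0"
    and U: "\<And>k. k \<in> {1..K} \<Longrightarrow> U k \<le> U K"
  obtains x where "\<forall>k\<in>{1..K}. 0 \<le> x k" "x \<in> offload_set K U l"
    "transmission_energy K \<tau> h N\<^sub>0 W x = E_off K \<tau> U h N\<^sub>0 W l"
    "\<And>y. (\<forall>k\<in>{1..K}. 0 \<le> y k) \<Longrightarrow> y \<in> offload_set K U l \<Longrightarrow>
       transmission_energy K \<tau> h N\<^sub>0 W x \<le> transmission_energy K \<tau> h N\<^sub>0 W y"
proof -
  define F where "F = {x. (\<forall>k\<in>{1..K}. 0 \<le> x k) \<and> x \<in> offload_set K U l}"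
  define B where "B = (\<lambda>k. if k \<in> {1..K} then {0..l} else {0::real})"
  define S where "S = Pi\<^sub>E UNIV B \<inter> offload_set K U l"
  have "compactin (product_topology (\<lambda>i. euclidean) (UNIV :: nat set)) (Pi\<^sub>E UNIV B)"
    by (subst compactin_PiE) (auto simp: B_def)
  then have comp: "compact (Pi\<^sub>E UNIV B)"
    by (simp add: euclidean_product_topology)
  have "closed (offload_set K U l)"
    unfolding offload_set_def Ball_def
    by (intro closed_Collect_conj closed_Collect_all closed_Collect_imp closed_Collect_le
          closed_Collect_eq continuous_intros continuous_on_sum continuous_on_product_coordinates)
       auto
  with comp have compS: "compact S"
    unfolding S_def by (rule compact_Int_closed)
  have cont: "continuous_on S (transmission_energy K \<tau> h N\<^sub>0 W)"
    unfolding transmission_energy_def rate_power_def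
    by (intro continuous_intros continuous_on_subset[OF continuous_on_product_coordinates]) (use \<tau> \<open>W \<noteq> 0\<close> in force)+
  define z where "z = (\<lambda>k::nat. if k = 1 then l else 0 :: real)"
  have zsum: "(\<Sum>j=1..k. z j) = l" if "1 \<le> k" for k :: nat
    using that by (simp add: z_def)
  have "z \<in> S"
  proof -
    have "max 0 (U k - (U K - l)) \<le> l" if "k \<in> {1..<K}" for k
      using U[of k] that \<open>0 \<le> l\<close> by auto
    then show ?thesis
      using zsum \<open>1 \<le> K\<close> \<open>0 \<le> l\<close> by (auto simp: S_def offload_set_def B_def z_def)
  qed
  then have "S \<noteq> {}" by blast
  from continuous_attains_inf[OF compS this cont] obtain x where
    x: "x \<in> S" "\<And>y. y \<in> S \<Longrightarrow> transmission_energy K \<tau> h N\<^sub>0 W x \<le> transmission_energy K \<tau> h N\<^sub>0 W y"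
    by blast
  have "x k \<in> B k" for k
    using x(1) unfolding S_def by blast
  then have "0 \<le> x k" if "k \<in> {1..K}" for k
    using that unfolding B_def by (metis atLeastAtMost_iff)
  then have xF: "x \<in> F"
    using x(1) by (auto simp: S_def F_def)
  have min: "transmission_energy K \<tau> h N\<^sub>0 W x \<le> transmission_energy K \<tau> h N\<^sub>0 W y" if "y \<in> F" for y
  proof -
    define y' where "y' = (\<lambda>k. if k \<in> {1..K} then y k else 0)"
    have same: "(\<Sum>j=1..k. y' j) = (\<Sum>j=1..k. y j)" if "k \<le> K" for k
      using that by (intro sum.cong) (auto simp: y'_def)
    have "y k \<le> l" if "k \<in> {1..K}" for k
    proof -
      have "y k \<le> (\<Sum>j=1..K. y j)"
        using that \<open>y \<in> F\<close> by (intro member_le_sum) (auto simp: F_def)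
      then show ?thesis using \<open>y \<in> F\<close> by (simp add: F_def offload_set_def)
    qed
    then have "y' \<in> S"
      using \<open>y \<in> F\<close> same by (auto simp: S_def F_def offload_set_def B_def y'_def)
    moreover have "transmission_energy K \<tau> h N\<^sub>0 W y' = transmission_energy K \<tau> h N\<^sub>0 W y"
      unfolding transmission_energy_def by (intro sum.cong) (auto simp: y'_def)
    ultimately show ?thesis using x(2) by metis
  qed
  have "E_off K \<tau> U h N\<^sub>0 W l = transmission_energy K \<tau> h N\<^sub>0 W x"
    unfolding E_off_def F_def[symmetric]
    by (rule cInf_eq_minimum) (use xF min in auto)
  then show thesis
    using that[of x] xF min by (auto simp: F_def)
qed

end

theory Submission
  imports Defs
begin

text \<open>
  The energy \<open>E_off\<close> is strictly convex on \<open>{0..}\<close>: convex combinations of optimal allocations for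
  two different loads are feasible for the combined load, the exponential rate function is strictly
  convex, and allocations of different loads differ in some epoch. Adding the affine
  local-computing cost preserves strict convexity, and \<open>l\<^sub>0\<close> is the stationary point of the total cost. A
  strictly convex function has its unique minimum over an interval at the projection of its
  stationary point onto that interval.
\<close>

section \<open>Strict convexity on the real line and minimization over an interval\<close>

definition strictly_convex_on :: "real set \<Rightarrow> (real \<Rightarrow> real) \<Rightarrow> bool" where
  "strictly_convex_on S f \<longleftrightarrow> convex S \<and>
     (\<forall>x\<in>S. \<forall>y\<in>S. \<forall>u. 0 < u \<longrightarrow> u < 1 \<longrightarrow> x \<noteq> y \<longrightarrow>
        f ((1 - u) * x + u * y) < (1 - u) * f x + u * f y)"

lemma strictly_convex_onI:
  assumes "convex S"
    and "\<And>x y u. \<lbrakk>x \<in> S; y \<in> S; 0 < u; u < 1; x \<noteq> y\<rbrakk> \<Longrightarrow>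
      f ((1 - u) * x + u * y) < (1 - u) * f x + u * f y"
  shows "strictly_convex_on S f"
  using assms by (auto simp: strictly_convex_on_def)

lemma strictly_convex_onD:
  assumes "strictly_convex_on S f" "x \<in> S" "y \<in> S" "0 < u" "u < 1" "x \<noteq> y"
  shows "f ((1 - u) * x + u * y) < (1 - u) * f x + u * f y"
  using assms by (auto simp: strictly_convex_on_def)

lemma strictly_convex_on_imp_convex_on:
  assumes "strictly_convex_on S f"
  shows "convex_on S f"
proof (rule convex_onI)
  fix t x y :: real
  assume "0 < t" "t < 1" "x \<in> S" "y \<in> S"
  then show "f ((1 - t) *\<^sub>R x + t *\<^sub>R y) \<le> (1 - t) * f x + t * f y"
    using strictly_convex_onD[OF assms, of x y t]
    by (cases "x = y") (auto simp: algebra_simps)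
qed (use assms in \<open>simp add: strictly_convex_on_def\<close>)

lemma strictly_convex_on_add_affine:
  assumes "strictly_convex_on S f"
  shows "strictly_convex_on S (\<lambda>x. (b - x) * c * d + f x)"
proof (rule strictly_convex_onI)
  fix x y u :: real
  assume "x \<in> S" "y \<in> S" "0 < u" "u < 1" "x \<noteq> y"
  then have "f ((1 - u) * x + u * y) < (1 - u) * f x + u * f y"
    using assms by (intro strictly_convex_onD)
  then show "(b - ((1 - u) * x + u * y)) * c * d + f ((1 - u) * x + u * y)
      < (1 - u) * ((b - x) * c * d + f x) + u * ((b - y) * c * d + f y)"
    by (simp add: algebra_simps)
qed (use assms in \<open>simp add: strictly_convex_on_def\<close>)

text \<open>Unlike \<open>convex_on_imp_above_tangent\<close>, this covers a boundary point of \<open>S\<close>.\<close>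

lemma convex_on_above_tangent_within:
  fixes f :: "real \<Rightarrow> real"
  assumes f: "convex_on S f" and "x \<in> S" "y \<in> S"
    and D: "(f has_real_derivative D) (at x within S)"
  shows "f x + D * (y - x) \<le> f y"
proof -
  \<comment> \<open>\<open>g\<close> runs along the segment from \<open>x\<close> to
    \<open>y\<close>, which stays in \<open>S\<close>, so a derivative within \<open>S\<close>
    suffices for the chain rule. By convexity the quotients \<open>(f (g u) - f x) / u\<close> are
    at most \<open>f y - f x\<close>, and their limit at 0 from the right is
    \<open>D * (y - x)\<close>.\<close>
  define g where "g = (\<lambda>u. x + u * (y - x))"
  have g_eq: "g u = (1 - u) *\<^sub>R x + u *\<^sub>R y" for u
    by (simp add: g_def algebra_simps)
  have "g u \<in> S" if "u \<in> {0..1}" for u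
    unfolding g_eq using f assms(2,3) that by (intro convexD_alt) (auto simp: convex_on_def)
  then have "g ` {0..1} \<subseteq> S" by blast
  then have "(f has_real_derivative D) (at (g 0) within g ` {0..1})"
    using D by (auto simp: g_def intro: DERIV_subset)
  moreover have "(g has_real_derivative (y - x)) (at 0 within {0..1})"
    unfolding g_def by (auto intro!: derivative_eq_intros)
  ultimately have "((f \<circ> g) has_real_derivative D * (y - x)) (at 0 within {0..1})"
    by (rule DERIV_image_chain)
  then have "((\<lambda>u. (f (g u) - f x) / u) \<longlongrightarrow> D * (y - x)) (at 0 within {0..1})"
    by (simp add: has_field_derivative_iff g_def)
  moreover have "(f (g u) - f x) / u \<le> f y - f x" if "0 < u" "u \<le> 1" for u
  proof -
    have "f (g u) \<le> (1 - u) * f x + u * f y"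
      unfolding g_eq using f that assms(2,3) by (intro convex_onD) auto
    then show ?thesis
      using that by (simp add: divide_simps) (simp add: algebra_simps)
  qed
  then have "\<forall>\<^sub>F u in at 0 within {0..1}. (f (g u) - f x) / u \<le> f y - f x"
    by (auto simp: eventually_at intro!: exI[of _ 1])
  moreover have "at (0::real) within {0..1} \<noteq> bot"
    by (simp add: at_within_Icc_at_right)
  ultimately have "D * (y - x) \<le> f y - f x"
    by (intro tendsto_upperbound)
  then show ?thesis by simp
qed

text \<open>The horizontal tangent makes \<open>z\<close> a global minimum on \<open>S\<close>,
  although \<open>z\<close> may lie outside \<open>{m..M}\<close>. The projection \<open>s\<close>
  of \<open>z\<close> either equals \<open>z\<close> or lies strictly between \<open>z\<close> and
  any other point \<open>y\<close> of the interval; in both cases strict convexity along the segment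
  from \<open>z\<close> to \<open>y\<close> gives \<open>f s < f y\<close>.\<close>

lemma is_arg_min_strictly_convex_interval:
  assumes f: "strictly_convex_on S f" and "z \<in> S" and D: "(f has_real_derivative 0) (at z within S)"
    and mM: "m \<le> M" and sub: "{m..M} \<subseteq> S"
  shows "is_arg_min f (\<lambda>x. m \<le> x \<and> x \<le> M) x \<longleftrightarrow> x = max m (min z M)"
proof -
  define s where "s = max m (min z M)"
  have min: "f z \<le> f y" if "y \<in> S" for y
    using convex_on_above_tangent_within[OF strictly_convex_on_imp_convex_on[OF f] \<open>z \<in> S\<close> that D]
    by simp
  have less: "f s < f y" if y: "m \<le> y" "y \<le> M" "y \<noteq> s" for y
  proof -
    have yS: "y \<in> S" using y sub by auto
    \<comment> \<open>A \<open>z\<close> in \<open>{m..M}\<close> is its own projection, so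
      \<open>y = z\<close> would force \<open>y = s\<close>.\<close>
    have "y \<noteq> z"
      using y by (auto simp: s_def)
    show ?thesis
    proof (cases "s = z")
      case True
      \<comment> \<open>The midpoint turns the weak bound \<open>f z \<le> f y\<close> into a strict
        one: its value is at least \<open>f z\<close> and strictly below the average of
        \<open>f z\<close> and \<open>f y\<close>.\<close>
      have "(1 - 1/2) * z + 1/2 * y \<in> S"
        using convexD_alt[of S z y "1/2"] f \<open>z \<in> S\<close> yS by (simp add: strictly_convex_on_def)
      then have "f z \<le> f ((1 - 1/2) * z + 1/2 * y)"
        by (rule min)
      also have "\<dots> < (1 - 1/2) * f z + 1/2 * f y"
        using \<open>y \<noteq> z\<close> yS \<open>z \<in> S\<close> by (intro strictly_convex_onD[OF f]) auto
      finally show ?thesis using True by simp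
    next
      case False
      \<comment> \<open>Here \<open>z\<close> is outside \<open>{m..M}\<close> and \<open>s\<close>
        is the endpoint nearest to it, so \<open>s\<close> is a proper convex combination of
        \<open>z\<close> and \<open>y\<close>, with weight \<open>u\<close> on
        \<open>y\<close>.\<close>
      define u where "u = (s - z) / (y - z)"
      have "u * (y - z) = s - z"
        using \<open>y \<noteq> z\<close> by (simp add: u_def)
      then have s: "s = (1 - u) * z + u * y"
        by (simp add: algebra_simps)
      have u: "0 < u" "u < 1"
        using y False \<open>y \<noteq> z\<close> mM
        by (auto simp: u_def s_def field_simps max_def min_def split: if_splits)
      have "f s < (1 - u) * f z + u * f y"
        by (subst s) (use u \<open>y \<noteq> z\<close> yS \<open>z \<in> S\<close> in \<open>auto intro!: strictly_convex_onD[OF f]\<close>)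
      also have "\<dots> \<le> (1 - u) * f y + u * f y"
        using u min[OF yS] by (intro add_right_mono mult_left_mono) auto
      finally show ?thesis by (simp add: algebra_simps)
    qed
  qed
  moreover have "m \<le> s" "s \<le> M"
    using mM by (auto simp: s_def)
  ultimately have "is_arg_min f (\<lambda>x. m \<le> x \<and> x \<le> M) x \<longleftrightarrow> x = s"
    unfolding is_arg_min_def by (metis less_asym)
  then show ?thesis by (simp add: s_def)
qed

section \<open>Strict convexity of the exponential and of the rate function\<close>

lemma exp_gt_tangent:
  fixes x m :: real
  assumes "x \<noteq> m"
  shows "exp m * (1 + (x - m)) < exp x"
proof -
  have "1 + (x - m) < exp (x - m)"
    using assms exp_minus_greater[of "m - x"] by simp
  then have "exp m * (1 + (x - m)) < exp m * exp (x - m)"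
    by simp
  then show ?thesis by (simp flip: exp_add)
qed

text \<open>Both endpoints are compared with the tangent at their combination \<open>m\<close>. In
  the weighted sum of the two tangent values the linear terms cancel, leaving
  \<open>exp m\<close>.\<close>

lemma strictly_convex_on_exp: "strictly_convex_on UNIV exp"
proof (rule strictly_convex_onI)
  fix x y u :: real
  assume u: "0 < u" "u < 1" and "x \<noteq> y"
  define m where "m = (1 - u) * x + u * y"
  have "x - m = u * (x - y)" "y - m = (1 - u) * (y - x)"
    by (simp_all add: m_def algebra_simps)
  then have "x \<noteq> m" "y \<noteq> m"
    using u \<open>x \<noteq> y\<close> by auto
  then have "(1 - u) * (exp m * (1 + (x - m))) + u * (exp m * (1 + (y - m)))
      < (1 - u) * exp x + u * exp y"
    using u by (intro add_strict_mono mult_strict_left_mono exp_gt_tangent) auto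
  also have "(1 - u) * (exp m * (1 + (x - m))) + u * (exp m * (1 + (y - m))) = exp m"
    by (simp add: m_def algebra_simps)
  finally show "exp ((1 - u) * x + u * y) < (1 - u) * exp x + u * exp y"
    by (simp add: m_def)
qed simp

lemma strictly_convex_on_rate_power:
  assumes "0 < N\<^sub>0" "0 < W"
  shows "strictly_convex_on UNIV (rate_power N\<^sub>0 W)"
proof (rule strictly_convex_onI)
  fix x y u :: real
  assume u: "0 < u" "u < 1" and "x \<noteq> y"
  \<comment> \<open>This \<open>c\<close> rewrites \<open>2 powr (t / W)\<close> as
    \<open>exp (c * t)\<close>; it is nonzero, so distinct rates give distinct exponents.\<close>
  define c where "c = ln 2 / W"
  have rate: "rate_power N\<^sub>0 W t = N\<^sub>0 * (exp (c * t) - 1)" for t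
    by (simp add: rate_power_def powr_def c_def)
  have "c * x \<noteq> c * y"
    using \<open>x \<noteq> y\<close> assms by (simp add: c_def)
  then have "exp ((1 - u) * (c * x) + u * (c * y)) < (1 - u) * exp (c * x) + u * exp (c * y)"
    using u by (intro strictly_convex_onD[OF strictly_convex_on_exp]) auto
  then have "N\<^sub>0 * exp (c * ((1 - u) * x + u * y))
      < N\<^sub>0 * ((1 - u) * exp (c * x) + u * exp (c * y))"
    using assms by (intro mult_strict_left_mono) (simp_all add: algebra_simps)
  then show "rate_power N\<^sub>0 W ((1 - u) * x + u * y)
      < (1 - u) * rate_power N\<^sub>0 W x + u * rate_power N\<^sub>0 W y"
    by (simp add: rate algebra_simps)
qed simp

section \<open>Strict convexity of the transmission energy and of \<open>E_off\<close>\<close>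

lemma transmission_energy_strictly_convex:
  assumes \<tau>: "\<And>k. k \<in> {1..K} \<Longrightarrow> 0 < \<tau> k" and pos: "0 < h" "0 < N\<^sub>0" "0 < W"
    and u: "0 < u" "u < 1" and i: "i \<in> {1..K}" "x i \<noteq> y i"
  shows "transmission_energy K \<tau> h N\<^sub>0 W (\<lambda>k. (1 - u) * x k + u * y k)
    < (1 - u) * transmission_energy K \<tau> h N\<^sub>0 W x + u * transmission_energy K \<tau> h N\<^sub>0 W y"
proof -
  let ?g = "rate_power N\<^sub>0 W"
  have split: "((1 - u) * x k + u * y k) / \<tau> k = (1 - u) * (x k / \<tau> k) + u * (y k / \<tau> k)" for k
    by (simp add: add_divide_distrib)
  have lt: "?g (((1 - u) * x k + u * y k) / \<tau> k) < (1 - u) * ?g (x k / \<tau> k) + u * ?g (y k / \<tau> k)"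
    if "k \<in> {1..K}" "x k \<noteq> y k" for k
    unfolding split using u that \<tau>[of k] pos
    by (intro strictly_convex_onD[OF strictly_convex_on_rate_power]) auto
  have le: "?g (((1 - u) * x k + u * y k) / \<tau> k) \<le> (1 - u) * ?g (x k / \<tau> k) + u * ?g (y k / \<tau> k)"
    if "k \<in> {1..K}" for k
    using lt[OF that] by (cases "x k = y k") (auto simp: algebra_simps)
  have "transmission_energy K \<tau> h N\<^sub>0 W (\<lambda>k. (1 - u) * x k + u * y k)
      < (\<Sum>k=1..K. \<tau> k / h\<^sup>2 * ((1 - u) * ?g (x k / \<tau> k) + u * ?g (y k / \<tau> k)))"
    unfolding transmission_energy_def
  \<comment> \<open>The allocations may agree in other epochs, so strictness comes from epoch
    \<open>i\<close> alone, where the weight \<open>\<tau> i / h\<^sup>2\<close> is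
    positive.\<close>
  proof (rule sum_strict_mono_ex1)
    show "\<forall>k\<in>{1..K}. \<tau> k / h\<^sup>2 * ?g (((1 - u) * x k + u * y k) / \<tau> k)
        \<le> \<tau> k / h\<^sup>2 * ((1 - u) * ?g (x k / \<tau> k) + u * ?g (y k / \<tau> k))"
      using \<tau> by (intro ballI mult_left_mono le) (auto simp: less_imp_le)
    show "\<exists>k\<in>{1..K}. \<tau> k / h\<^sup>2 * ?g (((1 - u) * x k + u * y k) / \<tau> k)
        < \<tau> k / h\<^sup>2 * ((1 - u) * ?g (x k / \<tau> k) + u * ?g (y k / \<tau> k))"
      using \<tau>[OF i(1)] i pos by (intro bexI[of _ i] mult_strict_left_mono lt) auto
  qed simp
  also have "\<dots> = (1 - u) * transmission_energy K \<tau> h N\<^sub>0 W x + u * transmission_energy K \<tau> h N\<^sub>0 W y"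
    unfolding transmission_energy_def sum_distrib_left sum.distrib[symmetric]
    by (intro sum.cong refl) (simp only: distrib_left mult.left_commute)
  finally show ?thesis .
qed

text \<open>The bounds on the partial sums are jointly convex in allocation and load: the upper
  bound is the load itself, and the lower one is the maximum of 0 and an affine function of the
  load, so it splits into two affine inequalities.\<close>

lemma offload_set_convex_comb:
  assumes x: "x \<in> offload_set K U l" and y: "y \<in> offload_set K U m" and u: "0 < u" "u < 1"
  shows "(\<lambda>k. (1 - u) * x k + u * y k) \<in> offload_set K U ((1 - u) * l + u * m)"
proof -
  have sum: "(\<Sum>j=1..k. (1 - u) * x j + u * y j)
      = (1 - u) * (\<Sum>j=1..k. x j) + u * (\<Sum>j=1..k. y j)" for k
    by (simp add: sum.distrib sum_distrib_left)
  have "max 0 (U k - (U K - ((1 - u) * l + u * m))) \<le> (1 - u) * (\<Sum>j=1..k. x j) + u * (\<Sum>j=1..k. y j)"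
    and "(1 - u) * (\<Sum>j=1..k. x j) + u * (\<Sum>j=1..k. y j) \<le> (1 - u) * l + u * m"
    if k: "k \<in> {1..<K}" for k
  proof -
    have X: "0 \<le> (\<Sum>j=1..k. x j)" "U k - (U K - l) \<le> (\<Sum>j=1..k. x j)" "(\<Sum>j=1..k. x j) \<le> l"
      and Y: "0 \<le> (\<Sum>j=1..k. y j)" "U k - (U K - m) \<le> (\<Sum>j=1..k. y j)" "(\<Sum>j=1..k. y j) \<le> m"
      using k x y by (auto simp: offload_set_def)
    have "(1 - u) * (U k - (U K - l)) + u * (U k - (U K - m))
        \<le> (1 - u) * (\<Sum>j=1..k. x j) + u * (\<Sum>j=1..k. y j)"
      using X Y u by (intro add_mono mult_left_mono) auto
    moreover have "0 \<le> (1 - u) * (\<Sum>j=1..k. x j) + u * (\<Sum>j=1..k. y j)"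
      using X Y u by simp
    ultimately show "max 0 (U k - (U K - ((1 - u) * l + u * m)))
        \<le> (1 - u) * (\<Sum>j=1..k. x j) + u * (\<Sum>j=1..k. y j)"
      by (simp add: algebra_simps)
    show "(1 - u) * (\<Sum>j=1..k. x j) + u * (\<Sum>j=1..k. y j) \<le> (1 - u) * l + u * m"
      using X Y u by (intro add_mono mult_left_mono) auto
  qed
  moreover have "(\<Sum>j=1..K. x j) = l" "(\<Sum>j=1..K. y j) = m"
    using x y by (auto simp: offload_set_def)
  ultimately show ?thesis
    unfolding offload_set_def mem_Collect_eq sum by simp
qed

text \<open>Attainment of the minimum keeps the inequality strict, since it is applied to actual
  optimal allocations. The domain reaches beyond \<open>U K\<close> so that a stationary point there
  is covered; for negative loads the constraint set is empty.\<close>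

lemma strictly_convex_on_E_off:
  assumes \<tau>: "\<And>k. k \<in> {1..K} \<Longrightarrow> 0 < \<tau> k" and "1 \<le> K" and pos: "0 < h" "0 < N\<^sub>0" "0 < W"
    and U: "\<And>k. k \<in> {1..K} \<Longrightarrow> U k \<le> U K"
  shows "strictly_convex_on {0..} (E_off K \<tau> U h N\<^sub>0 W)"
proof (rule strictly_convex_onI)
  let ?e = "transmission_energy K \<tau> h N\<^sub>0 W" and ?E = "E_off K \<tau> U h N\<^sub>0 W"
  fix l m u :: real
  assume lm: "l \<in> {0..}" "m \<in> {0..}" and u: "0 < u" "u < 1" and "l \<noteq> m"
  have "W \<noteq> 0" using pos by simp
  have attained: "\<exists>x. (\<forall>k\<in>{1..K}. 0 \<le> x k) \<and> x \<in> offload_set K U b \<and> ?e x = ?E b \<and>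
      (\<forall>y. (\<forall>k\<in>{1..K}. 0 \<le> y k) \<longrightarrow> y \<in> offload_set K U b \<longrightarrow> ?e x \<le> ?e y)"
    if "0 \<le> b" for b
    by (rule E_off_attained[of K \<tau> b W U h N\<^sub>0]) (use \<tau> \<open>1 \<le> K\<close> that \<open>W \<noteq> 0\<close> U in blast)+
  obtain x where x: "\<forall>k\<in>{1..K}. 0 \<le> x k" "x \<in> offload_set K U l" "?e x = ?E l"
    using attained[of l] lm by auto
  obtain y where y: "\<forall>k\<in>{1..K}. 0 \<le> y k" "y \<in> offload_set K U m" "?e y = ?E m"
    using attained[of m] lm by auto
  define z where "z = (\<lambda>k. (1 - u) * x k + u * y k)"
  have "(\<Sum>k=1..K. x k) \<noteq> (\<Sum>k=1..K. y k)"
    using x y \<open>l \<noteq> m\<close> by (simp add: offload_set_def)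
  then obtain i where i: "i \<in> {1..K}" "x i \<noteq> y i"
    by (metis sum.cong)
  have "0 \<le> (1 - u) * l + u * m"
    using lm u by simp
  moreover have "\<forall>k\<in>{1..K}. 0 \<le> z k"
    using x(1) y(1) u by (simp add: z_def)
  moreover have "z \<in> offload_set K U ((1 - u) * l + u * m)"
    unfolding z_def using x(2) y(2) u by (rule offload_set_convex_comb)
  \<comment> \<open>The third use of attainment is at the combined load, where \<open>z\<close> is
    only a feasible competitor of the optimal allocation.\<close>
  ultimately have "?E ((1 - u) * l + u * m) \<le> ?e z"
    using attained by metis
  also have "\<dots> < (1 - u) * ?e x + u * ?e y"
    unfolding z_def using \<tau> pos u i by (rule transmission_energy_strictly_convex)
  finally show "?E ((1 - u) * l + u * m) < (1 - u) * ?E l + u * ?E m"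
    using x(3) y(3) by simp
qed simp

section \<open>The optimal data partition\<close>

theorem proposition4:
  fixes L T f C P_cyc f\<^sub>h h N\<^sub>0 W l\<^sub>0 :: real
    and K :: nat
    and a \<tau> U :: "nat \<Rightarrow> real"
    and E :: "real \<Rightarrow> real"
    and l_min l :: real
  defines "U \<equiv> cpu_idling_profile a \<tau> f\<^sub>h C"
    and "E \<equiv> E_off K \<tau> U h N\<^sub>0 W"
    and "l_min \<equiv> max 0 (min_offload L f T C)"
  assumes "0 \<le> L" and "0 < T" and "0 < f" and "0 < C" and "0 < P_cyc" and "0 < f\<^sub>h"
    and "0 < h" and "0 < N\<^sub>0" and "0 < W"
    and "helper_timeline K T a \<tau>"
    and "l_min \<le> U K"
    and "0 \<le> l\<^sub>0" and "(E has_real_derivative C * P_cyc) (at l\<^sub>0 within {0..})"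
  shows "is_arg_min (\<lambda>l. (L - l) * C * P_cyc + E l) (\<lambda>l. l_min \<le> l \<and> l \<le> L \<and> l \<le> U K) l
         \<longleftrightarrow> l = max l_min (min l\<^sub>0 (min (U K) L))"
proof -
  have "strictly_convex_on {0..} E"
    unfolding E_def
  proof (rule strictly_convex_on_E_off)
    show "U k \<le> U K" if "k \<in> {1..K}" for k
      unfolding U_def using that assms by (intro cpu_idling_profile_mono) auto
  qed (use assms in \<open>auto simp: helper_timeline_def\<close>)
  then have "strictly_convex_on {0..} (\<lambda>l. (L - l) * C * P_cyc + E l)"
    by (rule strictly_convex_on_add_affine)
  \<comment> \<open>The local-computing cost has slope \<open>- C * P_cyc\<close>, which cancels the
    slope of \<open>E\<close> at \<open>l\<^sub>0\<close>. At \<open>l\<^sub>0 = 0\<close> the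
    derivative is one-sided.\<close>
  moreover have "((\<lambda>l. (L - l) * C * P_cyc + E l) has_real_derivative 0) (at l\<^sub>0 within {0..})"
    using assms by (auto intro!: derivative_eq_intros)
  moreover have "0 < f * T / C"
    using assms by simp
  \<comment> \<open>The two upper limits merge into one endpoint. The interval is nonempty:
    \<open>l_min \<le> U K\<close> is assumed, and \<open>l_min \<le> L\<close> follows from
    \<open>0 \<le> L\<close> and the positive local capacity \<open>f * T / C\<close>.\<close>
  then have "l_min \<le> min (U K) L"
    using assms by (simp add: l_min_def min_offload_def)
  moreover have "{l_min..min (U K) L} \<subseteq> {0..}"
    by (auto simp: l_min_def)
  ultimately have "is_arg_min (\<lambda>l. (L - l) * C * P_cyc + E l)
      (\<lambda>l. l_min \<le> l \<and> l \<le> min (U K) L) l \<longleftrightarrow> l = max l_min (min l\<^sub>0 (min (U K) L))"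
    using \<open>0 \<le> l\<^sub>0\<close> by (intro is_arg_min_strictly_convex_interval) auto
  then show ?thesis
    by (simp add: conj_commute)
qed

end
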